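(* Let $f,g$ be smooth, nowhere zero functions of $t$ on an open interval satisfying, for some constant $K$, $$g^3=f\exp\Big(\int\frac{K}{f}\,dt\Big)$$ for some antiderivative in the exponent. For a smooth function $w=w(z)$ put, for $y\ne0$, $$u=\frac1{f^{2/3}}\Big[w(z)-\frac{x(K+f')}{3f^{1/3}}-\frac{y^2}{6f^{4/3}}\Big(-\frac K3f'-\frac23f'^2+ff''\Big)\Big],\qquad z=\frac{y^3}{f^2}.$$ Then $u$ is invariant under both $\mathbf x_g$ and $\mathbf z_f$, and $u$ solves the ZK equation $u_{xt}-(uu_x)_x-u_{yy}=0$ if and only if $w$ satisfies the linear equation $$9z^{4/3}w''+6z^{1/3}w'+\frac{K^2}{9}=0,$$ whose solution is $w(z)=-\frac1{18}K^2z^{2/3}+3a_1z^{1/3}+a_2$ with constants $a_1,a_2$. Consequently $$u=\frac1{18f^2}\Big[\Big(18a_2+54a_1(y^3/f^2)^{1/3}-K^2(y^3/f^2)^{2/3}\Big)f^{4/3}\Big]+\frac1{18f^2}\Big(y^2f'(K+2f')-3f(2Kx+2xf'+y^2f'')\Big)$$ is a solution of the ZK equation.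
   Context: Vector fields on $(t,x,y,u)$-space: $\mathbf x_g=g\partial_x-g'\partial_u$, $\mathbf z_f=f\partial_t+\tfrac16(2xf'+y^2f'')\partial_x+\tfrac{2y}{3}f'\partial_y+\tfrac16(-4uf'-2xf''-y^2f''')\partial_u$. Primes on $f,g$ denote $d/dt$, primes on $w$ denote $d/dz$. Powers with denominator 3 are real ones (odd real cube root). A function $u(t,x,y)$ is invariant under a vector field if the field is tangent to its graph. *)

theory Defs
  imports "HOL-Analysis.Analysis"
begin

text \<open>
  Conventions. Powers with denominator 3 are written through the real odd cube root
  \<^term>\<open>root 3\<close>, e.g. \<^term>\<open>(root 3 s)^4\<close> for the 4/3-th power of \<^term>\<open>s\<close>.
  A function \<open>u(t,x,y)\<close> is curried; regions are sets of triples \<open>(t,x,y)\<close> and the total space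
  consists of quadruples \<open>(t,x,y,u)\<close>. Below, \<^const>\<open>deriv\<close> is only used for functions
  that are required to be differentiable where it is evaluated.
\<close>

text \<open>Only meant for open \<open>S\<close>, where the iterated \<^const>\<open>deriv\<close> depends on \<open>h\<close> restricted to \<open>S\<close> alone.\<close>

definition smooth_fun_on :: "real set \<Rightarrow> (real \<Rightarrow> real) \<Rightarrow> bool" where
  "smooth_fun_on S h \<longleftrightarrow> (\<forall>n. (deriv ^^ n) h differentiable_on S)"

type_synonym vfield = "real \<times> real \<times> real \<times> real \<Rightarrow> real \<times> real \<times> real \<times> real"

definition x_field :: "(real \<Rightarrow> real) \<Rightarrow> vfield" where
  "x_field g = (\<lambda>(t, x, y, u). (0, g t, 0, - deriv g t))"

definition z_field :: "(real \<Rightarrow> real) \<Rightarrow> vfield" where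
  "z_field f = (\<lambda>(t, x, y, u).
     (f t,
      (1/6) * (2 * x * deriv f t + y^2 * deriv (deriv f) t),
      (2 * y / 3) * deriv f t,
      (1/6) * (- 4 * u * deriv f t - 2 * x * deriv (deriv f) t
               - y^2 * deriv (deriv (deriv f)) t)))"

definition graph_map :: "(real \<Rightarrow> real \<Rightarrow> real \<Rightarrow> real) \<Rightarrow> real \<times> real \<times> real \<Rightarrow> real \<times> real \<times> real \<times> real" where
  "graph_map u = (\<lambda>(t, x, y). (t, x, y, u t x y))"

text \<open>The tangent space of the graph at \<open>graph_map u p\<close> is the range of the derivative of
  the parametrization \<open>graph_map u\<close> at \<open>p\<close>.\<close>

definition invariant_under_on ::
    "(real \<times> real \<times> real) set \<Rightarrow> vfield \<Rightarrow> (real \<Rightarrow> real \<Rightarrow> real \<Rightarrow> real) \<Rightarrow> bool" where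
  "invariant_under_on \<Omega> X u \<longleftrightarrow>
     (\<forall>p\<in>\<Omega>. graph_map u differentiable (at p) \<and>
            X (graph_map u p) \<in> range (frechet_derivative (graph_map u) (at p)))"

definition d_t :: "(real \<Rightarrow> real \<Rightarrow> real \<Rightarrow> real) \<Rightarrow> real \<Rightarrow> real \<Rightarrow> real \<Rightarrow> real" where
  "d_t u t x y = deriv (\<lambda>s. u s x y) t"

definition d_x :: "(real \<Rightarrow> real \<Rightarrow> real \<Rightarrow> real) \<Rightarrow> real \<Rightarrow> real \<Rightarrow> real \<Rightarrow> real" where
  "d_x u t x y = deriv (\<lambda>s. u t s y) x"

definition d_y :: "(real \<Rightarrow> real \<Rightarrow> real \<Rightarrow> real) \<Rightarrow> real \<Rightarrow> real \<Rightarrow> real \<Rightarrow> real" where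
  "d_y u t x y = deriv (\<lambda>s. u t x s) y"

text \<open>Classical solutions of \<open>u_xt - (u u_x)_x - u_yy = 0\<close>: all derivatives in the equation
  are required to exist.\<close>

definition zk_solution_on ::
    "(real \<times> real \<times> real) set \<Rightarrow> (real \<Rightarrow> real \<Rightarrow> real \<Rightarrow> real) \<Rightarrow> bool" where
  "zk_solution_on \<Omega> u \<longleftrightarrow>
     (\<forall>(t, x, y)\<in>\<Omega>.
        (\<lambda>s. u t s y) differentiable (at x) \<and>
        (\<lambda>s. d_x u s x y) differentiable (at t) \<and>
        (\<lambda>s. u t s y * d_x u t s y) differentiable (at x) \<and>
        (\<lambda>s. u t x s) differentiable (at y) \<and>
        (\<lambda>s. d_y u t x s) differentiable (at y) \<and>
        d_t (d_x u) t x y - d_x (\<lambda>t x y. u t x y * d_x u t x y) t x y - d_y (d_y u) t x y = 0)"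

definition sim_var :: "(real \<Rightarrow> real) \<Rightarrow> real \<Rightarrow> real \<Rightarrow> real" where
  "sim_var f t y = y^3 / (f t)^2"

definition zk_ansatz :: "(real \<Rightarrow> real) \<Rightarrow> real \<Rightarrow> (real \<Rightarrow> real) \<Rightarrow> real \<Rightarrow> real \<Rightarrow> real \<Rightarrow> real" where
  "zk_ansatz f K w t x y =
     1 / (root 3 (f t))^2 *
       (w (sim_var f t y)
        - x * (K + deriv f t) / (3 * root 3 (f t))
        - y^2 / (6 * (root 3 (f t))^4) *
            (- (K/3) * deriv f t - (2/3) * (deriv f t)^2 + f t * deriv (deriv f) t))"

definition ansatz_region :: "real set \<Rightarrow> real set \<Rightarrow> (real \<Rightarrow> real) \<Rightarrow> (real \<times> real \<times> real) set" where
  "ansatz_region I W f = {(t, x, y). t \<in> I \<and> y \<noteq> 0 \<and> sim_var f t y \<in> W}"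

definition reduced_ode_solution_on :: "real set \<Rightarrow> real \<Rightarrow> (real \<Rightarrow> real) \<Rightarrow> bool" where
  "reduced_ode_solution_on W K w \<longleftrightarrow>
     (\<forall>z\<in>W. w differentiable (at z) \<and> deriv w differentiable (at z) \<and>
        9 * (root 3 z)^4 * deriv (deriv w) z + 6 * root 3 z * deriv w z + K^2 / 9 = 0)"

definition w_sol :: "real \<Rightarrow> real \<Rightarrow> real \<Rightarrow> real \<Rightarrow> real" where
  "w_sol K a1 a2 z = - (1/18) * K^2 * (root 3 z)^2 + 3 * a1 * root 3 z + a2"

definition u_sol :: "(real \<Rightarrow> real) \<Rightarrow> real \<Rightarrow> real \<Rightarrow> real \<Rightarrow> real \<Rightarrow> real \<Rightarrow> real \<Rightarrow> real" where
  "u_sol f K a1 a2 t x y =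
     1 / (18 * (f t)^2) *
       ((18 * a2 + 54 * a1 * root 3 (y^3 / (f t)^2) - K^2 * (root 3 (y^3 / (f t)^2))^2)
          * (root 3 (f t))^4)
     + 1 / (18 * (f t)^2) *
       (y^2 * deriv f t * (K + 2 * deriv f t)
        - 3 * f t * (2 * K * x + 2 * x * deriv f t + y^2 * deriv (deriv f) t))"

end

theory Submission
  imports Defs
begin

text \<open>
  Since \<open>K/f\<close> is the logarithmic derivative of \<open>g^3/f\<close>, the slope
  \<open>P = -(K + f')/(3f)\<close> equals \<open>-g'/g\<close>. With \<open>E = f^(-2/3)\<close> the ansatz reads
  \<open>u = P x + E w(z) - Q y^2\<close>: it is affine in \<open>x\<close>, invariance amounts to linear identities between the
  derivatives of \<open>P\<close>, \<open>E\<close>, \<open>Q\<close>, and the ZK operator collapses to \<open>P' - P^2 - u_yy\<close>, which is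
  \<open>-1/f^2\<close> times the left-hand side of the reduced equation. The latter integrates once to
  \<open>z^(2/3) w' + K^2 z^(1/3) / 27 = const\<close>.
\<close>

section \<open>Real cube roots and differentiation in one variable\<close>

lemma cbrt_power3 [simp]: "(root 3 x)^3 = (x::real)"
  by (simp add: odd_real_root_pow)

lemma cbrt_has_derivative:
  assumes "(x::real) \<noteq> 0"
  shows "(root 3 has_real_derivative 1 / (3 * (root 3 x)^2)) (at x)"
proof -
  have "odd (3 :: nat)" by simp
  from DERIV_odd_real_root[OF this assms] show ?thesis
    by (simp add: numeral_2_eq_2[symmetric] inverse_eq_divide)
qed

lemma cbrt_similarity_variable: "root 3 (y^3 / (a::real)^2) = y / (root 3 a)^2"
  by (simp add: real_root_divide real_root_power odd_real_root_power_cancel)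

lemma smooth_fun_on_has_derivative:
  assumes "smooth_fun_on S h" "open S" "t \<in> S"
  shows "((deriv ^^ n) h has_real_derivative deriv ((deriv ^^ n) h) t) (at t)"
  using assms DERIV_deriv_iff_real_differentiable
  unfolding smooth_fun_on_def differentiable_on_def by (metis at_within_open)

lemma smooth_fun_on_derivs:
  assumes "smooth_fun_on S h" "open S" "t \<in> S"
  shows "(h has_real_derivative deriv h t) (at t)"
    and "(deriv h has_real_derivative deriv (deriv h) t) (at t)"
    and "(deriv (deriv h) has_real_derivative deriv (deriv (deriv h)) t) (at t)"
  using smooth_fun_on_has_derivative[OF assms, of 0] smooth_fun_on_has_derivative[OF assms, of 1]
    smooth_fun_on_has_derivative[OF assms, of 2] by (simp_all add: numeral_2_eq_2)

text \<open>The formula \<open>k\<close> is valid on a neighbourhood of \<open>x\<close>, so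
  \<open>deriv h\<close> coincides with \<open>k\<close> there. This is how second derivatives are
  obtained from explicit first ones.\<close>

lemma deriv_has_derivative_on_open:
  assumes "open S" "x \<in> S" "\<And>y. y \<in> S \<Longrightarrow> (h has_real_derivative k y) (at y)"
    and "(k has_real_derivative l) (at x)"
  shows "(deriv h has_real_derivative l) (at x)"
  using assms by (metis DERIV_imp_deriv has_field_derivative_transform_within_open)

lemma constant_on_connected_open:
  fixes h :: "real \<Rightarrow> real"
  assumes "open C" "connected C" "\<And>z. z \<in> C \<Longrightarrow> (h has_real_derivative 0) (at z)"
  obtains c where "\<And>z. z \<in> C \<Longrightarrow> h z = c"
  using has_field_derivative_zero_constant[of C h] assms
  by (metis DERIV_subset is_interval_connected_1 is_interval_convex_1 subset_UNIV)

section \<open>Functions affine in x, and tangency to graphs\<close>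

text \<open>For u = p x + q one has u_x = p and (u u_x)_x = p^2, so x drops out of the equation.
  Because u_x is formed before the t-derivative is taken, \<open>q\<close> enters only through its
  y-derivatives.\<close>

lemma zk_solution_on_affine_iff:
  fixes u :: "real \<Rightarrow> real \<Rightarrow> real \<Rightarrow> real"
  assumes u: "\<And>t x y. u t x y = p t * x + q t y"
    and Y: "\<And>t. t \<in> I \<Longrightarrow> open (Y t)"
    and p: "\<And>t. t \<in> I \<Longrightarrow> (p has_real_derivative p' t) (at t)"
    and q: "\<And>t y. t \<in> I \<Longrightarrow> y \<in> Y t \<Longrightarrow> (q t has_real_derivative qy t y) (at y)"
    and qy: "\<And>t y. t \<in> I \<Longrightarrow> y \<in> Y t \<Longrightarrow> (qy t has_real_derivative qyy t y) (at y)"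
  shows "zk_solution_on {(t, x, y). t \<in> I \<and> y \<in> Y t} u
    \<longleftrightarrow> (\<forall>t\<in>I. \<forall>y\<in>Y t. p' t - (p t)^2 - qyy t y = 0)"
proof -
  have x: "((\<lambda>s. u t s y) has_real_derivative p t) (at x)" for t x y
    unfolding u by (auto intro!: derivative_eq_intros)
  \<comment> \<open>The affine form holds for all t, x, y, so this is an identity of functions and
    can be rewritten underneath the outer derivatives.\<close>
  have d_x: "d_x u = (\<lambda>t x y. p t)"
    unfolding d_x_def using x by (auto intro!: ext DERIV_imp_deriv)
  have flux: "((\<lambda>s. u t s y * p t) has_real_derivative (p t)^2) (at x)" for t x y
    unfolding u by (auto intro!: derivative_eq_intros simp: power2_eq_square)
  have y: "((\<lambda>s. u t x s) has_real_derivative qy t y) (at y)" if "t \<in> I" "y \<in> Y t" for t x y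
    unfolding u using q[OF that] by (auto intro!: derivative_eq_intros)
  have yy: "((\<lambda>s. d_y u t x s) has_real_derivative qyy t y) (at y)" if "t \<in> I" "y \<in> Y t" for t x y
    unfolding d_y_def
    by (rule deriv_has_derivative_on_open[OF Y[OF that(1)] that(2) y[OF that(1)] qy[OF that]])
  have "d_t (d_x u) t x y = p' t" if "t \<in> I" for t x y
    unfolding d_x d_t_def using p[OF that] by (rule DERIV_imp_deriv)
  moreover have "d_x (\<lambda>t x y. u t x y * d_x u t x y) t x y = (p t)^2" for t x y
    unfolding d_x unfolding d_x_def by (rule DERIV_imp_deriv[OF flux])
  moreover have "d_y (d_y u) t x y = qyy t y" if "t \<in> I" "y \<in> Y t" for t x y
    unfolding d_y_def[of "d_y u"] using yy[OF that] by (rule DERIV_imp_deriv)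
  moreover have "(\<lambda>s. u t s y) differentiable (at x)" for t x y
    using x real_differentiable_def by blast
  moreover have "(\<lambda>s. d_x u s x y) differentiable (at t)" if "t \<in> I" for t x y
    unfolding d_x using p[OF that] real_differentiable_def by blast
  moreover have "(\<lambda>s. u t s y * d_x u t s y) differentiable (at x)" for t x y
    unfolding d_x using flux real_differentiable_def by blast
  moreover have "(\<lambda>s. u t x s) differentiable (at y)" if "t \<in> I" "y \<in> Y t" for t x y
    using y[OF that] real_differentiable_def by blast
  moreover have "(\<lambda>s. d_y u t x s) differentiable (at y)" if "t \<in> I" "y \<in> Y t" for t x y
    using yy[OF that] real_differentiable_def by blast
  ultimately show ?thesis
    unfolding zk_solution_on_def by auto
qed

text \<open>Tangent vectors of a graph are those whose last component is the differential of u
  applied to the first three, so tangency becomes one scalar equation. The partials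
  \<open>ut\<close>, \<open>ux\<close>, \<open>uy\<close> must come from a joint derivative, since
  the graph map itself has to be differentiable.\<close>

lemma invariant_under_onI:
  assumes "\<And>t x y. (t, x, y) \<in> \<Omega> \<Longrightarrow>
      ((\<lambda>p. u (fst p) (fst (snd p)) (snd (snd p))) has_derivative
        (\<lambda>h. fst h * ut t x y + fst (snd h) * ux t x y + snd (snd h) * uy t x y)) (at (t, x, y))"
    and "\<And>t x y. (t, x, y) \<in> \<Omega> \<Longrightarrow> case X (t, x, y, u t x y) of
      (a, b, c, d) \<Rightarrow> d = a * ut t x y + b * ux t x y + c * uy t x y"
  shows "invariant_under_on \<Omega> X u"
  unfolding invariant_under_on_def
proof (clarify, intro conjI)
  fix t x y assume *: "(t, x, y) \<in> \<Omega>"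
  define D where "D = (\<lambda>h::real \<times> real \<times> real. (fst h, fst (snd h), snd (snd h),
    fst h * ut t x y + fst (snd h) * ux t x y + snd (snd h) * uy t x y))"
  have "graph_map u = (\<lambda>p. (fst p, fst (snd p), snd (snd p), u (fst p) (fst (snd p)) (snd (snd p))))"
    by (auto simp: graph_map_def)
  then have D: "(graph_map u has_derivative D) (at (t, x, y))"
    unfolding D_def using assms(1)[OF *] by (auto intro!: derivative_eq_intros)
  then show "graph_map u differentiable (at (t, x, y))"
    by (rule differentiableI)
  \<comment> \<open>The first three components of the field supply the preimage under the derivative
    of the graph map.\<close>
  obtain a b c where "X (t, x, y, u t x y) = (a, b, c, a * ut t x y + b * ux t x y + c * uy t x y)"
    using assms(2)[OF *] by (auto split: prod.splits)
  then have "X (graph_map u (t, x, y)) = D (a, b, c)"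
    by (simp add: graph_map_def D_def)
  then show "X (graph_map u (t, x, y)) \<in> range (frechet_derivative (graph_map u) (at (t, x, y)))"
    using frechet_derivative_at[OF D] by simp
qed

subsection \<open>The ansatz\<close>

text \<open>\<open>slope\<close>, \<open>amplitude\<close> and \<open>quad\<close> are the
  coefficients P, E and Q in P x + E w(z) - Q y^2. Only E contains a cube root.\<close>

definition slope :: "(real \<Rightarrow> real) \<Rightarrow> real \<Rightarrow> real \<Rightarrow> real" where
  "slope f K t = - (K + deriv f t) / (3 * f t)"

definition amplitude :: "(real \<Rightarrow> real) \<Rightarrow> real \<Rightarrow> real" where
  "amplitude f t = 1 / (root 3 (f t))^2"

definition quad :: "(real \<Rightarrow> real) \<Rightarrow> real \<Rightarrow> real \<Rightarrow> real" where
  "quad f K t =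
    (- (K/3) * deriv f t - (2/3) * (deriv f t)^2 + f t * deriv (deriv f) t) / (6 * (f t)^2)"

lemma amplitude_cubed: "(amplitude f t)^3 = 1 / (f t)^2"
proof -
  have "((root 3 (f t))^2)^3 = ((root 3 (f t))^3)^2" by (simp only: power_mult[symmetric] mult.commute)
  then show ?thesis by (simp add: amplitude_def power_divide)
qed

lemma cbrt_sim_var: "root 3 (sim_var f t y) = y * amplitude f t"
  by (simp add: sim_var_def amplitude_def cbrt_similarity_variable)

lemma zk_ansatz_eq:
  "zk_ansatz f K w t x y = slope f K t * x + (amplitude f t * w (sim_var f t y) - quad f K t * y^2)"
proof -
  define r where "r = root 3 (f t)"
  have f: "f t = r^3" by (simp add: r_def)
  show ?thesis
    unfolding zk_ansatz_def slope_def amplitude_def quad_def r_def[symmetric] unfolding f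
    \<comment> \<open>If r = 0, all quotients are 0 by convention and both sides vanish. Hence the
      identity holds for every t, as \<open>zk_solution_on_affine_iff\<close> demands.\<close>
    by (cases "r = 0") (simp_all add: field_simps power_numeral_reduce)
qed

text \<open>The explicit solution is the ansatz with \<open>w_sol\<close> inserted: the cube root of
  z is y / r^2 with r the cube root of f, after which both sides are rational in r.\<close>

lemma u_sol_eq:
  "u_sol f K a1 a2 t x y = slope f K t * x + (amplitude f t * w_sol K a1 a2 (sim_var f t y) - quad f K t * y^2)"
proof -
  define r where "r = root 3 (f t)"
  have f: "f t = r^3" by (simp add: r_def)
  have z: "root 3 (y^3 / (r^3)^2) = y / r^2"
    unfolding cbrt_similarity_variable by (simp add: odd_real_root_power_cancel)
  show ?thesis
    unfolding u_sol_def w_sol_def sim_var_def slope_def amplitude_def quad_def r_def[symmetric] unfolding f z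
    by (cases "r = 0") (simp_all add: field_simps power_numeral_reduce)
qed

text \<open>The t-partial of the ansatz, with \<open>w'\<close> standing for the derivative of
  \<open>w\<close>. The four lines come from P', E', the t-derivative of z, and Q'.\<close>

definition ansatz_dt :: "(real \<Rightarrow> real) \<Rightarrow> real \<Rightarrow> (real \<Rightarrow> real) \<Rightarrow> (real \<Rightarrow> real) \<Rightarrow> real \<Rightarrow> real \<Rightarrow> real \<Rightarrow> real"
  where "ansatz_dt f K w w' t x y =
    ((K + deriv f t) * deriv f t - f t * deriv (deriv f) t) / (3 * (f t)^2) * x
     - (2/3) * deriv f t / f t * amplitude f t * w (sim_var f t y)
     - amplitude f t * w' (sim_var f t y) * (2 * y^3 * deriv f t / (f t)^3)
     - ((- (K/3) * deriv (deriv f) t - (1/3) * deriv f t * deriv (deriv f) t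
        + f t * deriv (deriv (deriv f)) t) / (6 * (f t)^2) - 2 * deriv f t / f t * quad f K t) * y^2"

definition ansatz_dy :: "(real \<Rightarrow> real) \<Rightarrow> real \<Rightarrow> (real \<Rightarrow> real) \<Rightarrow> real \<Rightarrow> real \<Rightarrow> real"
  where "ansatz_dy f K w' t y =
    amplitude f t * w' (sim_var f t y) * (3 * y^2 / (f t)^2) - 2 * quad f K t * y"

section \<open>Derivatives of the coefficients and of the ansatz\<close>

context
  fixes f :: "real \<Rightarrow> real" and I :: "real set"
  assumes I: "open I" and f: "smooth_fun_on I f" and f_nz: "\<forall>t\<in>I. f t \<noteq> 0"
begin

lemma slope_has_derivative:
  assumes "t \<in> I"
  shows "(slope f K has_real_derivative
    ((K + deriv f t) * deriv f t - f t * deriv (deriv f) t) / (3 * (f t)^2)) (at t)"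
  unfolding slope_def using f_nz assms
  by (auto intro!: derivative_eq_intros smooth_fun_on_derivs[OF f I assms]
      simp: field_simps power2_eq_square)

lemma amplitude_has_derivative:
  assumes "t \<in> I"
  shows "(amplitude f has_real_derivative - (2/3) * deriv f t / f t * amplitude f t) (at t)"
proof -
  define r where "r = root 3 (f t)"
  have ft: "f t = r^3" by (simp add: r_def)
  have r: "r \<noteq> 0" using f_nz assms by (auto simp: r_def)
  have root: "((\<lambda>s. root 3 (f s)) has_real_derivative 1 / (3 * r^2) * deriv f t) (at t)"
    using DERIV_chain2[OF cbrt_has_derivative smooth_fun_on_derivs(1)[OF f I assms]] f_nz assms
    unfolding r_def by blast
  have "((\<lambda>s. inverse ((root 3 (f s))^2)) has_real_derivative
      - (inverse (r^2) * (2 * (1 / (3 * r^2) * deriv f t) * r) * inverse (r^2))) (at t)"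
    using DERIV_inverse'[OF DERIV_power[OF root, of 2]] r
    by (simp add: r_def[symmetric] mult.assoc)
  note D = this[unfolded inverse_eq_divide]
  show ?thesis
    unfolding amplitude_def r_def[symmetric]
    by (rule DERIV_cong[OF D]) (use r in \<open>simp add: ft field_simps power_numeral_reduce\<close>)
qed

text \<open>The coefficient -1/3 of f' f'' is -4/3 from the square of f' plus 1 from (f f'')'.
  Differentiating the factor 1/f^2 produces the term with -2 f'/f.\<close>

lemma quad_has_derivative:
  assumes "t \<in> I"
  shows "(quad f K has_real_derivative
    (- (K/3) * deriv (deriv f) t - (1/3) * deriv f t * deriv (deriv f) t
      + f t * deriv (deriv (deriv f)) t) / (6 * (f t)^2) - 2 * deriv f t / f t * quad f K t) (at t)"
  unfolding quad_def using f_nz assms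
  by (auto intro!: derivative_eq_intros smooth_fun_on_derivs[OF f I assms])
    (simp add: field_simps power_numeral_reduce)

text \<open>Each coefficient is pulled back along a projection, which yields joint differentiability
  in (t, x, y) and not only the partials. The x-partial is \<open>slope\<close>.\<close>

lemma zk_ansatz_has_derivative:
  assumes "t \<in> I" and w: "(w has_real_derivative w' (sim_var f t y)) (at (sim_var f t y))"
  shows "((\<lambda>p. zk_ansatz f K w (fst p) (fst (snd p)) (snd (snd p))) has_derivative
    (\<lambda>h. fst h * ansatz_dt f K w w' t x y + fst (snd h) * slope f K t
        + snd (snd h) * ansatz_dy f K w' t y)) (at (t, x, y))"
proof -
  have ft: "f t \<noteq> 0" using f_nz assms by blast
  have fst': "(fst has_derivative fst) (at (t, x, y))"
    by (rule has_derivative_fst[OF has_derivative_ident])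
  have f': "((\<lambda>p. f (fst p)) has_derivative (\<lambda>h. fst h * deriv f t)) (at (t, x, y))"
    by (rule DERIV_compose_FDERIV[OF _ fst']) (simp add: smooth_fun_on_derivs(1)[OF f I assms(1)])
  have P: "((\<lambda>p. slope f K (fst p)) has_derivative (\<lambda>h. fst h *
      (((K + deriv f t) * deriv f t - f t * deriv (deriv f) t) / (3 * (f t)^2)))) (at (t, x, y))"
    by (rule DERIV_compose_FDERIV[OF _ fst']) (simp add: slope_has_derivative[OF assms(1)])
  have E: "((\<lambda>p. amplitude f (fst p)) has_derivative
      (\<lambda>h. fst h * (- (2/3) * deriv f t / f t * amplitude f t))) (at (t, x, y))"
    by (rule DERIV_compose_FDERIV[OF _ fst']) (simp only: fst_conv amplitude_has_derivative[OF assms(1)])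
  have Q: "((\<lambda>p. quad f K (fst p)) has_derivative (\<lambda>h. fst h *
      ((- (K/3) * deriv (deriv f) t - (1/3) * deriv f t * deriv (deriv f) t
      + f t * deriv (deriv (deriv f)) t) / (6 * (f t)^2) - 2 * deriv f t / f t * quad f K t))) (at (t, x, y))"
    by (rule DERIV_compose_FDERIV[OF _ fst']) (simp only: fst_conv quad_has_derivative[OF assms(1)])
  have z: "((\<lambda>p. sim_var f (fst p) (snd (snd p))) has_derivative (\<lambda>h.
      snd (snd h) * (3 * y^2 / (f t)^2) - fst h * (2 * y^3 * deriv f t / (f t)^3))) (at (t, x, y))"
    unfolding sim_var_def using ft
    by (auto intro!: derivative_eq_intros f' ext) (simp add: field_simps power_numeral_reduce)
  have W: "((\<lambda>p. w (sim_var f (fst p) (snd (snd p)))) has_derivative (\<lambda>h.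
      (snd (snd h) * (3 * y^2 / (f t)^2) - fst h * (2 * y^3 * deriv f t / (f t)^3)) * w' (sim_var f t y))) (at (t, x, y))"
    by (rule DERIV_compose_FDERIV[OF _ z]) (simp add: w)
  show ?thesis
    unfolding zk_ansatz_eq ansatz_dt_def ansatz_dy_def
    by (rule has_derivative_eq_rhs, (rule derivative_intros P E Q W)+)
      (auto intro!: ext simp: algebra_simps)
qed

section \<open>Invariance under the two vector fields\<close>

text \<open>The field has no t- or y-component, so tangency says -g' = g u_x with u_x =
  \<open>slope\<close>, whatever \<open>w\<close> is.\<close>

lemma zk_ansatz_invariant_x_field:
  assumes w: "\<And>z. z \<in> W \<Longrightarrow> (w has_real_derivative w' z) (at z)"
    and g: "\<And>t. t \<in> I \<Longrightarrow> deriv g t = - slope f K t * g t"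
  shows "invariant_under_on (ansatz_region I W f) (x_field g) (zk_ansatz f K w)"
proof (rule invariant_under_onI)
  fix t x y assume "(t, x, y) \<in> ansatz_region I W f"
  then have t: "t \<in> I" and z: "sim_var f t y \<in> W" by (auto simp: ansatz_region_def)
  show "((\<lambda>p. zk_ansatz f K w (fst p) (fst (snd p)) (snd (snd p))) has_derivative
        (\<lambda>h. fst h * ansatz_dt f K w w' t x y + fst (snd h) * slope f K t + snd (snd h) * ansatz_dy f K w' t y)) (at (t, x, y))"
    by (rule zk_ansatz_has_derivative, rule t, rule w, rule z)
  show "case x_field g (t, x, y, zk_ansatz f K w t x y) of (a, b, c, d) \<Rightarrow>
      d = a * ansatz_dt f K w w' t x y + b * slope f K t + c * ansatz_dy f K w' t y"
    by (simp add: x_field_def g[OF t])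
qed

text \<open>The similarity variable is annihilated: f z_t + (2y/3) f' z_y = 0, so the terms with
  \<open>w'\<close> cancel. The terms with \<open>w\<close> match because E' = -(2/3) (f'/f) E, and
  the x and y^2 terms are identities in f and its derivatives.\<close>

lemma zk_ansatz_invariant_z_field:
  assumes w: "\<And>z. z \<in> W \<Longrightarrow> (w has_real_derivative w' z) (at z)"
  shows "invariant_under_on (ansatz_region I W f) (z_field f) (zk_ansatz f K w)"
proof (rule invariant_under_onI)
  fix t x y assume "(t, x, y) \<in> ansatz_region I W f"
  then have t: "t \<in> I" and z: "sim_var f t y \<in> W" by (auto simp: ansatz_region_def)
  show "((\<lambda>p. zk_ansatz f K w (fst p) (fst (snd p)) (snd (snd p))) has_derivative
        (\<lambda>h. fst h * ansatz_dt f K w w' t x y + fst (snd h) * slope f K t + snd (snd h) * ansatz_dy f K w' t y)) (at (t, x, y))"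
    by (rule zk_ansatz_has_derivative, rule t, rule w, rule z)
  have ft: "f t \<noteq> 0" using f_nz t by blast
  \<comment> \<open>With 1/f as an atom and \<open>ansatz_dt\<close> multiplied by f, tangency
    becomes a polynomial identity in which \<open>quad\<close> and \<open>amplitude\<close> stay
    unexpanded.\<close>
  define i where "i = 1 / f t"
  have slope: "slope f K t = - (K + deriv f t) * i / 3"
    by (simp add: slope_def i_def)
  have dt: "f t * ansatz_dt f K w w' t x y
      = ((K + deriv f t) * deriv f t * i / 3 - deriv (deriv f) t / 3) * x
        - (2/3) * deriv f t * amplitude f t * w (sim_var f t y)
        - amplitude f t * w' (sim_var f t y) * (2 * y^3 * deriv f t * i^2)
        - ((deriv (deriv (deriv f)) t - (K + deriv f t) * deriv (deriv f) t * i / 3) / 6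
           - 2 * deriv f t * quad f K t) * y^2"
    unfolding ansatz_dt_def i_def using ft by (simp add: field_simps power_numeral_reduce)
  have dy: "ansatz_dy f K w' t y
      = 3 * amplitude f t * w' (sim_var f t y) * y^2 * i^2 - 2 * quad f K t * y"
    unfolding ansatz_dy_def i_def by (simp add: power_divide)
  have "(1/6) * (- 4 * zk_ansatz f K w t x y * deriv f t - 2 * x * deriv (deriv f) t
        - y^2 * deriv (deriv (deriv f)) t)
      = f t * ansatz_dt f K w w' t x y
        + (1/6) * (2 * x * deriv f t + y^2 * deriv (deriv f) t) * slope f K t
        + (2 * y / 3 * deriv f t) * ansatz_dy f K w' t y"
    unfolding zk_ansatz_eq dt dy unfolding slope
    by (simp add: field_simps power_numeral_reduce)
  then show "case z_field f (t, x, y, zk_ansatz f K w t x y) of (a, b, c, d) \<Rightarrow>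
      d = a * ansatz_dt f K w w' t x y + b * slope f K t + c * ansatz_dy f K w' t y"
    unfolding z_field_def by simp
qed

section \<open>Reduction of the ZK equation to the equation for w\<close>

lemma zk_ansatz_solution_iff:
  assumes "I \<noteq> {}" "open W" "0 \<notin> W" and w: "smooth_fun_on W w"
  shows "zk_solution_on (ansatz_region I W f) (zk_ansatz f K w) \<longleftrightarrow> reduced_ode_solution_on W K w"
proof -
  define Y where "Y t = {y. sim_var f t y \<in> W}" for t
  define L where "L z = 9 * (root 3 z)^4 * deriv (deriv w) z + 6 * root 3 z * deriv w z + K^2 / 9" for z
  define qy where "qy t y = amplitude f t * (deriv w (sim_var f t y) * (3 * y^2 / (f t)^2))
    - 2 * quad f K t * y" for t y
  define qyy where "qyy t y = amplitude f t * (deriv (deriv w) (sim_var f t y) * (3 * y^2 / (f t)^2)^2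
    + deriv w (sim_var f t y) * (6 * y / (f t)^2)) - 2 * quad f K t" for t y
  define p' where "p' t = ((K + deriv f t) * deriv f t - f t * deriv (deriv f) t) / (3 * (f t)^2)" for t
  \<comment> \<open>The condition y \<noteq> 0 is automatic here, since y = 0 would give z = 0,
    which lies outside \<open>W\<close>.\<close>
  have region: "ansatz_region I W f = {(t, x, y). t \<in> I \<and> y \<in> Y t}"
    using \<open>0 \<notin> W\<close> by (auto simp: ansatz_region_def Y_def sim_var_def)
  have zy: "(sim_var f t has_real_derivative 3 * y^2 / (f t)^2) (at y)" for t y
    unfolding sim_var_def by (auto intro!: derivative_eq_intros simp: divide_inverse)
  have openY: "open (Y t)" for t
    using open_vimage[OF \<open>open W\<close>, of "sim_var f t"] zy[of t]
    by (auto simp: Y_def vimage_def continuous_on_eq_continuous_at intro: DERIV_isCont)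
  have w1: "((\<lambda>y. w (sim_var f t y)) has_real_derivative
      deriv w (sim_var f t y) * (3 * y^2 / (f t)^2)) (at y)" if "y \<in> Y t" for t y
    using DERIV_chain2[OF smooth_fun_on_derivs(1)[OF w \<open>open W\<close>] zy] that by (simp add: Y_def)
  have w2: "((\<lambda>y. deriv w (sim_var f t y)) has_real_derivative
      deriv (deriv w) (sim_var f t y) * (3 * y^2 / (f t)^2)) (at y)" if "y \<in> Y t" for t y
    using DERIV_chain2[OF smooth_fun_on_derivs(2)[OF w \<open>open W\<close>] zy] that by (simp add: Y_def)
  have "zk_solution_on (ansatz_region I W f) (zk_ansatz f K w)
      \<longleftrightarrow> (\<forall>t\<in>I. \<forall>y\<in>Y t. p' t - (slope f K t)^2 - qyy t y = 0)"
    unfolding region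
  proof (rule zk_solution_on_affine_iff[OF zk_ansatz_eq openY, where qy = qy])
    show "(slope f K has_real_derivative p' t) (at t)" if "t \<in> I" for t
      unfolding p'_def by (rule slope_has_derivative[OF that])
    show "((\<lambda>y. amplitude f t * w (sim_var f t y) - quad f K t * y^2) has_real_derivative qy t y) (at y)"
      if "t \<in> I" "y \<in> Y t" for t y
      unfolding qy_def by (rule derivative_eq_intros w1[OF that(2)] refl)+ simp
    show "(qy t has_real_derivative qyy t y) (at y)" if "t \<in> I" "y \<in> Y t" for t y
      unfolding qy_def qyy_def divide_inverse
      by (rule derivative_eq_intros w2[OF that(2), unfolded divide_inverse] refl)+
        (simp add: algebra_simps power2_eq_square)
  qed
  also have "\<dots> \<longleftrightarrow> (\<forall>t\<in>I. \<forall>y\<in>Y t. L (sim_var f t y) = 0)"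
  proof -
    have "p' t - (slope f K t)^2 - qyy t y = - L (sim_var f t y) / (f t)^2" if "t \<in> I" for t y
    proof -
      \<comment> \<open>Since 1/f^2 = E^3 and z^(1/3) = y E, both the w-part of u_yy and
        \<open>L\<close> become polynomial in y and E. The w-free part is P' - P^2 + 2 Q = -K^2 / (9
        f^2), the constant term of the reduced equation.\<close>
      define E where "E = amplitude f t"
      have inv: "1 / (f t)^2 = E^3" by (simp add: E_def amplitude_cubed)
      have "f t \<noteq> 0" using f_nz that by blast
      then have "p' t - (slope f K t)^2 + 2 * quad f K t = - (K^2 / 9) * (1 / (f t)^2)"
        unfolding p'_def slope_def quad_def by (simp add: field_simps power_numeral_reduce)
      moreover have "qyy t y + 2 * quad f K t = E * (deriv (deriv w) (sim_var f t y) * (3 * y^2 * (1 / (f t)^2))^2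
          + deriv w (sim_var f t y) * (6 * y * (1 / (f t)^2)))"
        by (simp add: qyy_def E_def)
      moreover have "- L (sim_var f t y) / (f t)^2 = - L (sim_var f t y) * (1 / (f t)^2)" by simp
      ultimately show ?thesis
        unfolding L_def cbrt_sim_var E_def[symmetric] inv
        by (simp add: algebra_simps power_numeral_reduce)
    qed
    then show ?thesis using f_nz by simp
  qed
  also have "\<dots> \<longleftrightarrow> (\<forall>z\<in>W. L z = 0)"
  proof -
    \<comment> \<open>A single t suffices: for fixed t the map from y to z is onto, with y the cube
      root of z f^2, so every point of \<open>W\<close> is reached.\<close>
    obtain t where t: "t \<in> I" using \<open>I \<noteq> {}\<close> by blast
    have "sim_var f t (root 3 (z * (f t)^2)) = z" for z
      using f_nz t by (simp add: sim_var_def)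
    then show ?thesis
      using t unfolding Y_def by (metis mem_Collect_eq)
  qed
  also have "\<dots> \<longleftrightarrow> reduced_ode_solution_on W K w"
    using smooth_fun_on_derivs(1,2)[OF w \<open>open W\<close>]
    unfolding reduced_ode_solution_on_def L_def real_differentiable_def by blast
  finally show ?thesis .
qed

text \<open>The equivalence for the ansatz excludes z = 0, so it says nothing at y = 0. But z^(1/3)
  = y E makes the explicit solution a quadratic polynomial in y, and the equation can be checked
  directly for all y.\<close>

lemma u_sol_solution: "zk_solution_on (I \<times> UNIV) (u_sol f K a1 a2)"
proof -
  define q where "q t y = amplitude f t * w_sol K a1 a2 (sim_var f t y) - quad f K t * y^2" for t y
  have q_eq: "q t y = a2 * amplitude f t + 3 * a1 * (amplitude f t)^2 * y
      - ((1/18) * K^2 / (f t)^2 + quad f K t) * y^2" for t y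
  proof -
    have "q t y = a2 * amplitude f t + 3 * a1 * (amplitude f t)^2 * y
      - ((1/18) * K^2 * (amplitude f t)^3 + quad f K t) * y^2"
      unfolding q_def w_sol_def cbrt_sim_var by (simp add: algebra_simps power_numeral_reduce)
    then show ?thesis by (simp add: amplitude_cubed)
  qed
  have "zk_solution_on {(t, x, y). t \<in> I \<and> y \<in> UNIV} (u_sol f K a1 a2) \<longleftrightarrow>
    (\<forall>t\<in>I. \<forall>y\<in>(UNIV :: real set).
      ((K + deriv f t) * deriv f t - f t * deriv (deriv f) t) / (3 * (f t)^2) - (slope f K t)^2
        - (- 2 * ((1/18) * K^2 / (f t)^2 + quad f K t)) = 0)"
  proof (rule zk_solution_on_affine_iff[OF _ _ slope_has_derivative])
    show "u_sol f K a1 a2 t x y = slope f K t * x + q t y" for t x y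
      by (simp add: u_sol_eq q_def)
    show "(q t has_real_derivative
        3 * a1 * (amplitude f t)^2 - 2 * ((1/18) * K^2 / (f t)^2 + quad f K t) * y) (at y)" for t y
      unfolding q_eq by (rule derivative_eq_intros refl)+ simp
    show "((\<lambda>y. 3 * a1 * (amplitude f t)^2 - 2 * ((1/18) * K^2 / (f t)^2 + quad f K t) * y)
        has_real_derivative - 2 * ((1/18) * K^2 / (f t)^2 + quad f K t)) (at y)" for t y
      by (rule derivative_eq_intros refl)+ simp
  qed auto
  \<comment> \<open>Again P' - P^2 + 2 Q = -K^2 / (9 f^2), now cancelled by the K^2 term of
    u_yy.\<close>
  moreover have "((K + deriv f t) * deriv f t - f t * deriv (deriv f) t) / (3 * (f t)^2)
      - (slope f K t)^2 - (- 2 * ((1/18) * K^2 / (f t)^2 + quad f K t)) = 0" if "t \<in> I" for t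
    using f_nz that unfolding slope_def quad_def by (simp add: field_simps power_numeral_reduce)
  moreover have "{(t, x, y). t \<in> I \<and> y \<in> UNIV} = I \<times> (UNIV :: (real \<times> real) set)" by auto
  ultimately show ?thesis by simp
qed

end

subsection \<open>The reduced equation\<close>

lemma w_sol_has_derivative:
  assumes "z \<noteq> 0"
  shows "(w_sol K a1 a2 has_real_derivative a1 / (root 3 z)^2 - K^2 / (27 * root 3 z)) (at z)"
  unfolding w_sol_def using assms
  by (auto intro!: derivative_eq_intros cbrt_has_derivative simp: field_simps power2_eq_square)

lemma w_sol_has_second_derivative:
  assumes "z \<noteq> 0"
  shows "((\<lambda>z. a1 / (root 3 z)^2 - K^2 / (27 * root 3 z)) has_real_derivative
    K^2 / (81 * (root 3 z)^4) - 2 * a1 / (3 * (root 3 z)^5)) (at z)"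
  using assms
  by (auto intro!: derivative_eq_intros cbrt_has_derivative)
    (simp add: field_simps power_numeral_reduce)

text \<open>On substitution the \<open>a1\<close> terms cancel and the K^2 terms add up to 1/9 - 2/9
  + 1/9 = 0. Openness of \<open>C\<close> transfers the derivatives of \<open>w_sol\<close> to
  \<open>v\<close>.\<close>

lemma w_sol_reduced_ode:
  assumes "open C" "0 \<notin> C" and v: "\<forall>z\<in>C. v z = w_sol K a1 a2 z"
  shows "reduced_ode_solution_on C K v"
  unfolding reduced_ode_solution_on_def
proof
  fix z assume z: "z \<in> C"
  have v1: "(v has_real_derivative a1 / (root 3 z)^2 - K^2 / (27 * root 3 z)) (at z)" if "z \<in> C" for z
    using has_field_derivative_transform_within_open[OF w_sol_has_derivative \<open>open C\<close> that]
      v that \<open>0 \<notin> C\<close> by metis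
  have z0: "z \<noteq> 0" using z \<open>0 \<notin> C\<close> by blast
  have v2: "(deriv v has_real_derivative K^2 / (81 * (root 3 z)^4) - 2 * a1 / (3 * (root 3 z)^5)) (at z)"
    by (rule deriv_has_derivative_on_open[OF \<open>open C\<close> z v1 w_sol_has_second_derivative[OF z0]])
  show "v differentiable (at z) \<and> deriv v differentiable (at z) \<and>
      9 * (root 3 z)^4 * deriv (deriv v) z + 6 * root 3 z * deriv v z + K^2 / 9 = 0"
    using v1[OF z] v2 z0 unfolding DERIV_imp_deriv[OF v1[OF z]] DERIV_imp_deriv[OF v2]
    by (auto simp: real_differentiable_def) (simp add: field_simps power_numeral_reduce)
qed

text \<open>Division by 9 z^(2/3) makes the equation exact. Its first integral defines
  \<open>a1\<close>, a second integration gives \<open>a2\<close>, and connectedness of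
  \<open>C\<close> makes each a single constant.\<close>

lemma reduced_ode_imp_w_sol:
  assumes C: "open C" "connected C" "0 \<notin> C" and v: "reduced_ode_solution_on C K v"
  shows "\<exists>a1 a2. \<forall>z\<in>C. v z = w_sol K a1 a2 z"
proof -
  have v1: "(v has_real_derivative deriv v z) (at z)"
    and v2: "(deriv v has_real_derivative deriv (deriv v) z) (at z)"
    and ode: "9 * (root 3 z)^4 * deriv (deriv v) z + 6 * root 3 z * deriv v z + K^2 / 9 = 0"
    if "z \<in> C" for z
    using v that by (auto simp: reduced_ode_solution_on_def DERIV_deriv_iff_real_differentiable)
  obtain a1 where a1: "(root 3 z)^2 * deriv v z + K^2 / 27 * root 3 z = a1" if "z \<in> C" for z
  proof (rule constant_on_connected_open[OF C(1,2)])
    fix z assume z: "z \<in> C"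
    then have z0: "z \<noteq> 0" using C by blast
    have eq: "2 * root 3 z * (1 / (3 * (root 3 z)^2)) * deriv v z + (root 3 z)^2 * deriv (deriv v) z
        + K^2 / 27 * (1 / (3 * (root 3 z)^2))
      = (9 * (root 3 z)^4 * deriv (deriv v) z + 6 * root 3 z * deriv v z + K^2 / 9) / (9 * (root 3 z)^2)"
      using z0 by (simp add: field_simps power_numeral_reduce)
    show "((\<lambda>z. (root 3 z)^2 * deriv v z + K^2 / 27 * root 3 z) has_real_derivative 0) (at z)"
      by (rule derivative_eq_intros cbrt_has_derivative[OF z0] v2[OF z] refl)+
        (use eq ode[OF z] in \<open>simp add: algebra_simps\<close>)
  qed blast
  \<comment> \<open>With 0 as last parameter of \<open>w_sol\<close>, the difference is precisely
    the remaining additive constant.\<close>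
  obtain a2 where a2: "v z - w_sol K a1 0 z = a2" if "z \<in> C" for z
  proof (rule constant_on_connected_open[OF C(1,2)])
    fix z assume z: "z \<in> C"
    then have z0: "z \<noteq> 0" using C by blast
    have "deriv v z = a1 / (root 3 z)^2 - K^2 / (27 * root 3 z)"
      using a1[OF z] z0 by (simp add: field_simps power2_eq_square)
    then show "((\<lambda>z. v z - w_sol K a1 0 z) has_real_derivative 0) (at z)"
      using DERIV_diff[OF v1[OF z] w_sol_has_derivative[OF z0, of K a1 0]] by simp
  qed blast
  have "\<forall>z\<in>C. v z = w_sol K a1 a2 z"
    using a2 by (fastforce simp: w_sol_def)
  then show ?thesis by blast
qed

section \<open>The relation between f and g\<close>

text \<open>Differentiating g^3 = f exp(F) itself, without taking logarithms, covers both signs of f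
  and g.\<close>

lemma deriv_cube_eq_exp:
  assumes "open I" "t \<in> I" and g: "smooth_fun_on I g" and f: "smooth_fun_on I f"
    and nz: "f t \<noteq> 0" "g t \<noteq> 0"
    and F: "\<forall>t\<in>I. (F has_real_derivative K / f t) (at t) \<and> (g t)^3 = f t * exp (F t)"
  shows "deriv g t = - slope f K t * g t"
proof -
  have "((\<lambda>t. f t * exp (F t)) has_real_derivative (deriv f t + K) * exp (F t)) (at t)"
    using F assms(2) nz
    by (auto intro!: derivative_eq_intros smooth_fun_on_derivs(1)[OF f \<open>open I\<close>] simp: field_simps)
  then have "((\<lambda>t. (g t)^3) has_real_derivative (deriv f t + K) * exp (F t)) (at t)"
    using has_field_derivative_transform_within_open[OF _ \<open>open I\<close> \<open>t \<in> I\<close>] F by simp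
  moreover have "((\<lambda>t. (g t)^3) has_real_derivative 3 * (g t)^2 * deriv g t) (at t)"
    using smooth_fun_on_derivs(1)[OF g assms(1,2)] by (auto intro!: derivative_eq_intros)
  ultimately have "3 * (g t)^2 * deriv g t = (deriv f t + K) * exp (F t)"
    by (rule DERIV_unique[symmetric])
  \<comment> \<open>Multiplying by f turns exp(F) back into g^3, after which g^2 cancels.\<close>
  then have "3 * f t * deriv g t * (g t)^2 = (deriv f t + K) * (f t * exp (F t))"
    by (simp add: algebra_simps)
  also have "\<dots> = (deriv f t + K) * g t * (g t)^2"
    using F assms(2) by (simp add: power_numeral_reduce)
  finally have "3 * f t * deriv g t = (deriv f t + K) * g t"
    using nz by simp
  then show ?thesis
    using nz by (simp add: slope_def field_simps)
qed

text \<open>The existential \<open>F\<close> is the antiderivative in the exponent. The general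
  solution is stated on connected sets avoiding 0, because the constants may differ on the two sides
  of 0.\<close>

theorem mainTheorem8:
  fixes f g w :: "real \<Rightarrow> real" and K :: real and I W :: "real set"
  assumes "open I" "is_interval I" "I \<noteq> {}"
    and "smooth_fun_on I f" "smooth_fun_on I g"
    and "\<forall>t\<in>I. f t \<noteq> 0" "\<forall>t\<in>I. g t \<noteq> 0"
    and "\<exists>F. \<forall>t\<in>I. (F has_real_derivative K / f t) (at t) \<and> (g t)^3 = f t * exp (F t)"
    and "open W" "0 \<notin> W" "smooth_fun_on W w"
  shows "invariant_under_on (ansatz_region I W f) (x_field g) (zk_ansatz f K w)
    \<and> invariant_under_on (ansatz_region I W f) (z_field f) (zk_ansatz f K w)
    \<and> (zk_solution_on (ansatz_region I W f) (zk_ansatz f K w)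
         \<longleftrightarrow> reduced_ode_solution_on W K w)
    \<and> (\<forall>C v. open C \<and> connected C \<and> 0 \<notin> C \<longrightarrow>
         (reduced_ode_solution_on C K v
            \<longleftrightarrow> (\<exists>a1 a2. \<forall>z\<in>C. v z = w_sol K a1 a2 z)))
    \<and> (\<forall>a1 a2.
         (\<forall>t\<in>I. \<forall>x y. y \<noteq> 0 \<longrightarrow> zk_ansatz f K (w_sol K a1 a2) t x y = u_sol f K a1 a2 t x y)
       \<and> zk_solution_on (I \<times> UNIV) (u_sol f K a1 a2))"
proof (intro conjI allI impI ballI)
  note f = assms(4) and nz = assms(6)
  have w: "(w has_real_derivative deriv w z) (at z)" if "z \<in> W" for z
    by (rule smooth_fun_on_derivs(1)[OF assms(11,9) that])
  obtain F where "\<forall>t\<in>I. (F has_real_derivative K / f t) (at t) \<and> (g t)^3 = f t * exp (F t)"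
    using assms(8) by blast
  then have "deriv g t = - slope f K t * g t" if "t \<in> I" for t
    using deriv_cube_eq_exp[OF assms(1) that assms(5) f] assms(6,7) that by blast
  note g = this
  show "invariant_under_on (ansatz_region I W f) (x_field g) (zk_ansatz f K w)"
    by (rule zk_ansatz_invariant_x_field[OF assms(1) f nz w g])
  show "invariant_under_on (ansatz_region I W f) (z_field f) (zk_ansatz f K w)"
    by (rule zk_ansatz_invariant_z_field[OF assms(1) f nz w])
  show "zk_solution_on (ansatz_region I W f) (zk_ansatz f K w) \<longleftrightarrow> reduced_ode_solution_on W K w"
    by (rule zk_ansatz_solution_iff[OF assms(1) f nz assms(3,9,10,11)])
  show "reduced_ode_solution_on C K v \<longleftrightarrow> (\<exists>a1 a2. \<forall>z\<in>C. v z = w_sol K a1 a2 z)"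
    if "open C \<and> connected C \<and> 0 \<notin> C" for C v
  proof
    assume "reduced_ode_solution_on C K v"
    then show "\<exists>a1 a2. \<forall>z\<in>C. v z = w_sol K a1 a2 z"
      using that by (intro reduced_ode_imp_w_sol) auto
  next
    assume "\<exists>a1 a2. \<forall>z\<in>C. v z = w_sol K a1 a2 z"
    then show "reduced_ode_solution_on C K v"
      using that by (auto intro: w_sol_reduced_ode)
  qed
  show "zk_ansatz f K (w_sol K a1 a2) t x y = u_sol f K a1 a2 t x y" for a1 a2 t x y
    by (simp add: zk_ansatz_eq u_sol_eq)
  show "zk_solution_on (I \<times> UNIV) (u_sol f K a1 a2)" for a1 a2
    by (rule u_sol_solution[OF assms(1) f nz])
qed

end
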